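(* Let $s \ge 2$ and let $X$ be an $s$-distance set in $\mathbb{R}^d$ with $A(X) = \{\alpha_1, \alpha_2, \ldots, \alpha_s\}$. Let $N = \binom{d+s-1}{s-1} + \binom{d+s-2}{s-2}$. If $|X| \ge 2N$, then for each $i = 1, 2, \ldots, s$ the number \[ k_i = \prod_{j=1,\ldots,s,\ j \neq i} \frac{\alpha_j^2}{\alpha_j^2 - \alpha_i^2} \] is an integer, and $|k_i| \le U(N)$.
   Context: A finite set $X \subset \mathbb{R}^d$ is called an $s$-distance set if $|A(X)| = s$, where $A(X) = \{ d(x,y) : x, y \in X, x \neq y\}$ and $d(x,y)$ is the Euclidean distance. The function $U$ is defined by $U(N) = \left\lfloor \frac{1}{2} + \sqrt{\frac{N^2}{2N-2} + \frac{1}{4}} \right\rfloor$. *)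

theory Defs
  imports "HOL-Analysis.Analysis"
begin

definition dist_set :: "'a::metric_space set \<Rightarrow> real set" where
  "dist_set X = {dist x y | x y. x \<in> X \<and> y \<in> X \<and> x \<noteq> y}"

definition s_distance_set :: "nat \<Rightarrow> 'a::metric_space set \<Rightarrow> bool" where
  "s_distance_set s X \<longleftrightarrow> finite X \<and> card (dist_set X) = s"

definition U :: "nat \<Rightarrow> int" where
  "U N = \<lfloor>1/2 + sqrt ((real N)^2 / (2 * real N - 2) + 1/4)\<rfloor>"

end

theory Submission
  imports Defs "Jordan_Normal_Form.Schur_Decomposition"
begin

text \<open>Restrict to \<open>2N\<close> points and let \<open>M x y = (\<Prod>j\<noteq>i. (\<alpha>\<^sub>j\<^sup>2 - d(x,y)\<^sup>2) / (\<alpha>\<^sub>j\<^sup>2 - \<alpha>\<^sub>i\<^sup>2))\<close>. Then \<open>M = k I + A\<close> with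
  \<open>k = k\<^sub>i\<close> and \<open>A\<close> the adjacency matrix of the graph of pairs at distance \<open>\<alpha>\<^sub>i\<close>, while \<open>M\<close> has rank at
  most \<open>N\<close>, because its rows are restrictions of polynomials from a space of dimension at most \<open>N\<close>.

  So \<open>-k\<close> is a root of multiplicity at least \<open>N\<close> of the characteristic polynomial of \<open>A\<close>, which is
  monic, integral and of degree \<open>2N\<close>. If \<open>-k\<close> is rational, it is an integer. Otherwise this polynomial is
  a power of the quadratic minimal polynomial \<open>x\<^sup>2 + b x + c\<close> of \<open>-k\<close>; as \<open>A\<close> is symmetric,
  \<open>A\<^sup>2 + b A + c I = 0\<close>. Hence the graph is a disjoint union of cliques of size \<open>1 - c\<close>,
  \<open>b = 1 + c\<close>, and the quadratic has the rational roots \<open>-1\<close> and \<open>-c\<close>, a contradiction.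

  For the bound, \<open>S = M - J/2\<close>, with \<open>J\<close> the all-ones matrix, has rank at most \<open>N + 1\<close> and all
  off-diagonal entries \<open>\<plusminus>1/2\<close>, so \<open>(tr S)\<^sup>2 \<le> rank S \<cdot> \<parallel>S\<parallel>\<^sup>2\<close> bounds \<open>|k - 1/2|\<close>.\<close>

hide_const (open) Determinants.det

section \<open>The size bound\<close>

text \<open>Gram-Schmidt by induction on \<open>r\<close>. A vector dependent on its predecessors
  yields a zero vector instead of being dropped, so the index range stays \<open>r\<close>.\<close>

lemma orthonormalize:
  fixes u :: "nat \<Rightarrow> nat \<Rightarrow> real"
  shows "\<exists>e w. (\<forall>a<r. \<forall>i<n. u a i = (\<Sum>b<r. w a b * e b i))
     \<and> (\<forall>a<r. \<forall>b<r. a \<noteq> b \<longrightarrow> (\<Sum>i<n. e a i * e b i) = 0)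
     \<and> (\<forall>a<r. (\<Sum>i<n. e a i * e a i) = 1 \<or> (\<forall>i<n. e a i = 0))"
proof (induction r)
  case (Suc r)
  then obtain e w where span: "\<And>a i. a < r \<Longrightarrow> i < n \<Longrightarrow> u a i = (\<Sum>b<r. w a b * e b i)"
    and orth: "\<And>a b. a < r \<Longrightarrow> b < r \<Longrightarrow> a \<noteq> b \<Longrightarrow> (\<Sum>i<n. e a i * e b i) = 0"
    and unit: "\<And>a. a < r \<Longrightarrow> (\<Sum>i<n. e a i * e a i) = 1 \<or> (\<forall>i<n. e a i = 0)"
    by auto
  define c where "c b = (\<Sum>i<n. u r i * e b i)" for b
  define v where "v i = u r i - (\<Sum>b<r. c b * e b i)" for i
  define \<nu> where "\<nu> = sqrt (\<Sum>i<n. v i * v i)"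
  have v_orth: "(\<Sum>i<n. v i * e a i) = 0" if a: "a < r" for a
  proof -
    have "(\<Sum>i<n. (\<Sum>b<r. c b * e b i) * e a i) = (\<Sum>b<r. c b * (\<Sum>i<n. e b i * e a i))"
      by (simp add: sum_distrib_left sum_distrib_right mult.assoc sum.swap[of _ "{..<r}"])
    also have "\<dots> = (\<Sum>b<r. if b = a then c a * (\<Sum>i<n. e a i * e a i) else 0)"
      by (intro sum.cong) (auto simp: orth a)
    also have "\<dots> = c a * (\<Sum>i<n. e a i * e a i)" using a by simp
    also have "\<dots> = c a" using unit[OF a] by (auto simp: c_def)
    finally show ?thesis by (simp add: v_def left_diff_distrib sum_subtractf c_def)
  qed
  have nonneg: "(\<Sum>i<n. v i * v i) \<ge> 0" by (simp add: sum_nonneg)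
  have \<nu>_zero: "\<nu> = 0 \<longleftrightarrow> (\<forall>i<n. v i = 0)"
    unfolding \<nu>_def real_sqrt_eq_0_iff by (subst sum_nonneg_eq_0_iff) auto
  \<comment> \<open>If \<open>v\<close> vanishes on the range, then \<open>\<nu> = 0\<close>, and
    division by zero makes the new vector zero, which is the second alternative of the
    claim.\<close>
  define e' where "e' = e(r := \<lambda>i. v i / \<nu>)"
  define w' where "w' = (\<lambda>a b. if a < r then if b < r then w a b else 0 else if b < r then c b else \<nu>)"
  have e'_r: "e' r i = v i / \<nu>" for i by (simp add: e'_def)
  have e'_less: "a < r \<Longrightarrow> e' a = e a" for a by (simp add: e'_def)
  have "u a i = (\<Sum>b<Suc r. w' a b * e' b i)" if "a < Suc r" "i < n" for a i
  proof (cases "a < r")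
    case True
    then show ?thesis using that by (simp add: span w'_def e'_less)
  next
    case False
    then have "a = r" using that by simp
    moreover have "\<nu> * (v i / \<nu>) = v i" using \<nu>_zero that by auto
    ultimately show ?thesis by (simp add: w'_def e'_less e'_r v_def)
  qed
  moreover have "(\<Sum>i<n. e' a i * e' b i) = 0" if "a < Suc r" "b < Suc r" "a \<noteq> b" for a b
  proof -
    have *: "(\<Sum>i<n. v i / \<nu> * e a i) = 0" "(\<Sum>i<n. e a i * (v i / \<nu>)) = 0" if "a < r" for a
      using v_orth[OF that] by (simp_all add: mult.commute flip: sum_divide_distrib)
    from that have "a < r \<and> b < r \<or> a = r \<and> b < r \<or> a < r \<and> b = r" by linarith
    then show ?thesis
      by (elim disjE) (use * orth that in \<open>simp_all add: e'_less e'_r\<close>)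
  qed
  moreover have "(\<Sum>i<n. e' a i * e' a i) = 1 \<or> (\<forall>i<n. e' a i = 0)" if "a < Suc r" for a
  proof (cases "a < r")
    case False
    then have a: "a = r" using that by simp
    have "(\<Sum>i<n. v i * v i) = \<nu> * \<nu>" using nonneg by (simp add: \<nu>_def)
    then have "(\<Sum>i<n. e' a i * e' a i) = 1" if "\<nu> \<noteq> 0"
      using that by (simp add: a e'_r flip: sum_divide_distrib)
    then show ?thesis by (auto simp: a e'_r)
  qed (use unit e'_less in auto)
  ultimately show ?case by blast
qed simp

text \<open>Orthonormalizing the left factors gives \<open>S\<close> as the sum of the products
  \<open>e a i * t a j\<close>, where \<open>t a\<close> is the transpose of \<open>S\<close>
  applied to \<open>e a\<close>. The trace is then the sum of the inner products of
  \<open>e a\<close> and \<open>t a\<close>. In Cauchy-Schwarz the \<open>e a\<close> contribute at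
  most \<open>r\<close>, the \<open>t a\<close> exactly the squared Frobenius norm.\<close>

lemma square_trace_le_rank_mult_frobenius:
  fixes S :: "nat \<Rightarrow> nat \<Rightarrow> real"
  assumes S: "\<And>i j. i < n \<Longrightarrow> j < n \<Longrightarrow> S i j = (\<Sum>a<r. p a i * q a j)"
  shows "(\<Sum>i<n. S i i)\<^sup>2 \<le> real r * (\<Sum>i<n. \<Sum>j<n. (S i j)\<^sup>2)"
proof -
  obtain e w where span: "\<And>a i. a < r \<Longrightarrow> i < n \<Longrightarrow> p a i = (\<Sum>b<r. w a b * e b i)"
    and orth: "\<And>a b. a < r \<Longrightarrow> b < r \<Longrightarrow> a \<noteq> b \<Longrightarrow> (\<Sum>i<n. e a i * e b i) = 0"
    and unit: "\<And>a. a < r \<Longrightarrow> (\<Sum>i<n. e a i * e a i) = 1 \<or> (\<forall>i<n. e a i = 0)"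
    using orthonormalize[of r n p] by auto
  define c where "c b j = (\<Sum>a<r. w a b * q a j)" for b j
  define t where "t a j = (\<Sum>i<n. e a i * S i j)" for a j
  have S_c: "S i j = (\<Sum>b<r. e b i * c b j)" if "i < n" "j < n" for i j
  proof -
    have "S i j = (\<Sum>a<r. \<Sum>b<r. w a b * e b i * q a j)"
      using that by (simp add: S span sum_distrib_right)
    also have "\<dots> = (\<Sum>b<r. \<Sum>a<r. w a b * e b i * q a j)" by (rule sum.swap)
    finally show ?thesis by (simp add: c_def sum_distrib_left mult_ac)
  qed
  have t: "t a j = c a j * (\<Sum>i<n. e a i * e a i)" if a: "a < r" and "j < n" for a j
  proof -
    have "t a j = (\<Sum>i<n. \<Sum>b<r. e a i * (e b i * c b j))"
      using that by (simp add: t_def S_c sum_distrib_left)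
    also have "\<dots> = (\<Sum>b<r. \<Sum>i<n. e a i * (e b i * c b j))" by (rule sum.swap)
    also have "\<dots> = (\<Sum>b<r. c b j * (\<Sum>i<n. e a i * e b i))"
      by (simp add: sum_distrib_left mult_ac)
    also have "\<dots> = (\<Sum>b<r. if b = a then c a j * (\<Sum>i<n. e a i * e a i) else 0)"
      by (intro sum.cong) (auto simp: orth a)
    finally show ?thesis using a by simp
  qed
  \<comment> \<open>For a unit vector \<open>e a\<close> the coefficient \<open>c a j\<close> equals
    \<open>t a j\<close>; for a zero vector both terms vanish.\<close>
  have S_t: "S i j = (\<Sum>a<r. e a i * t a j)" if "i < n" "j < n" for i j
    unfolding S_c[OF that]
    by (intro sum.cong refl) (use unit that in \<open>auto simp: t\<close>)
  have col: "(\<Sum>i<n. (S i j)\<^sup>2) = (\<Sum>a<r. (t a j)\<^sup>2)" if "j < n" for j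
  proof -
    have "(\<Sum>i<n. (S i j)\<^sup>2) = (\<Sum>i<n. \<Sum>a<r. S i j * (e a i * t a j))"
      unfolding power2_eq_square sum_distrib_left[symmetric]
      by (intro sum.cong refl) (use S_t that in auto)
    also have "\<dots> = (\<Sum>a<r. \<Sum>i<n. S i j * (e a i * t a j))" by (rule sum.swap)
    also have "\<dots> = (\<Sum>a<r. t a j * t a j)"
      by (simp add: t_def sum_distrib_right sum_distrib_left mult_ac)
    finally show ?thesis by (simp add: power2_eq_square)
  qed
  let ?I = "{..<r} \<times> {..<n}"
  have "(\<Sum>i<n. S i i) = (\<Sum>i<n. \<Sum>a<r. e a i * t a i)" by (simp add: S_t)
  also have "\<dots> = (\<Sum>a<r. \<Sum>i<n. e a i * t a i)" by (rule sum.swap)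
  also have "\<dots> = (\<Sum>(a,i)\<in>?I. e a i * t a i)" by (rule sum.cartesian_product)
  finally have "(\<Sum>i<n. S i i)\<^sup>2 \<le> (\<Sum>(a,i)\<in>?I. (e a i)\<^sup>2) * (\<Sum>(a,i)\<in>?I. (t a i)\<^sup>2)"
    using Cauchy_Schwarz_ineq_sum[of "case_prod e" "case_prod t" ?I]
    by (simp add: case_prod_unfold)
  also have "(\<Sum>(a,i)\<in>?I. (t a i)\<^sup>2) = (\<Sum>a<r. \<Sum>j<n. (t a j)\<^sup>2)"
    by (simp only: sum.cartesian_product)
  also have "\<dots> = (\<Sum>j<n. \<Sum>a<r. (t a j)\<^sup>2)" by (rule sum.swap)
  also have "\<dots> = (\<Sum>j<n. \<Sum>i<n. (S i j)\<^sup>2)" by (simp add: col)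
  also have "\<dots> = (\<Sum>i<n. \<Sum>j<n. (S i j)\<^sup>2)" by (rule sum.swap)
  also have "(\<Sum>(a,i)\<in>?I. (e a i)\<^sup>2) = (\<Sum>a<r. \<Sum>i<n. e a i * e a i)"
    by (simp only: sum.cartesian_product power2_eq_square)
  also have "\<dots> \<le> (\<Sum>a<r. 1)"
    by (intro sum_mono) (use unit in fastforce)
  finally show ?thesis by (simp add: mult_right_mono sum_nonneg)
qed

lemma low_rank_abs_diagonal_le_U:
  fixes k :: real
  assumes N: "N \<ge> 2"
    and fact: "\<And>i j. i < 2 * N \<Longrightarrow> j < 2 * N \<Longrightarrow>
      (if i = j then k else of_bool (E i j)) = (\<Sum>a<N. p a i * q a j)"
  shows "\<lfloor>\<bar>k\<bar>\<rfloor> \<le> U N"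
proof -
  let ?n = "2 * N"
  define S where "S i j = (if i = j then k else of_bool (E i j)) - 1 / 2" for i j
  define p' where "p' a i = (if a < N then p a i else 1)" for a i
  \<comment> \<open>The shift by \<open>- 1 / 2\<close> costs one extra rank-one term, at index
    \<open>N\<close>.\<close>
  define q' where "q' a i = (if a < N then q a i else - 1 / 2)" for a i
  have "S i j = (\<Sum>a<Suc N. p' a i * q' a j)" if "i < ?n" "j < ?n" for i j
    using fact[OF that] by (simp add: S_def p'_def q'_def)
  then have "(\<Sum>i<?n. S i i)\<^sup>2 \<le> real (Suc N) * (\<Sum>i<?n. \<Sum>j<?n. (S i j)\<^sup>2)"
    by (rule square_trace_le_rank_mult_frobenius)
  also have "(\<Sum>j<?n. (S i j)\<^sup>2) = (k - 1/2)\<^sup>2 + (real ?n - 1) / 4" if "i < ?n" for i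
  proof -
    have "(\<Sum>j<?n. (S i j)\<^sup>2) = (\<Sum>j<?n. 1 / 4 + (if i = j then (k - 1/2)\<^sup>2 - 1 / 4 else 0))"
      by (intro sum.cong refl) (auto simp: S_def power2_eq_square)
    also have "\<dots> = real ?n / 4 + ((k - 1/2)\<^sup>2 - 1 / 4)"
      using that by (simp add: sum.distrib)
    finally show ?thesis by (simp add: field_simps)
  qed
  then have "(\<Sum>i<?n. \<Sum>j<?n. (S i j)\<^sup>2) = real ?n * ((k - 1/2)\<^sup>2 + (real ?n - 1) / 4)"
    by simp
  also have "(\<Sum>i<?n. S i i) = real ?n * (k - 1/2)" by (simp add: S_def)
  finally have "real ?n * (real ?n * (k - 1/2)\<^sup>2) \<le>
      real ?n * (real (Suc N) * ((k - 1/2)\<^sup>2 + (real ?n - 1) / 4))"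
    by (simp add: power2_eq_square field_simps)
  then have "real ?n * (k - 1/2)\<^sup>2 \<le> real (Suc N) * ((k - 1/2)\<^sup>2 + (real ?n - 1) / 4)"
    using N by (simp only: mult_le_cancel_left_pos)
  then have "(real N - 1) * (k - 1/2)\<^sup>2 \<le> (real N + 1) * (2 * real N - 1) / 4"
    by (simp add: algebra_simps) (simp add: field_simps)
  then have "(k - 1/2)\<^sup>2 \<le> (real N + 1) * (2 * real N - 1) / 4 / (real N - 1)"
    using N by (simp add: pos_le_divide_eq) (simp add: algebra_simps)
  also have "\<dots> = (real N)\<^sup>2 / (2 * real N - 2) + 1 / 4"
    using N by (simp add: divide_simps) (simp add: algebra_simps power2_eq_square)
  finally have "\<bar>k - 1/2\<bar> \<le> sqrt ((real N)\<^sup>2 / (2 * real N - 2) + 1 / 4)"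
    by (metis real_sqrt_abs real_sqrt_le_mono)
  \<comment> \<open>Here \<open>\<bar>k\<bar> \<le> 1/2 + \<bar>k - 1/2\<bar>\<close>, which is
    where the summand \<open>1/2\<close> in \<open>U\<close> comes from.\<close>
  then show ?thesis unfolding U_def by (intro floor_mono) linarith
qed

section \<open>Integrality\<close>

text \<open>An irrational \<open>z\<close> has a minimal polynomial \<open>p\<close> of degree at
  least 2, of which it is a simple root. Order at least \<open>N\<close> at \<open>z\<close> thus
  makes \<open>p ^ N\<close> divide \<open>P\<close>, and degree \<open>2 * N\<close> leaves only a
  constant cofactor and degree 2 for \<open>p\<close>. Hence every root of \<open>P\<close> is a
  root of \<open>p\<close>.\<close>

lemma quadratic_minimal_polynomial_if_large_order:
  fixes P :: "rat poly" and z :: complex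
  assumes deg: "degree P = 2 * N" and N: "N > 0"
    and ord: "[:- z, 1:] ^ N dvd map_poly of_rat P"
    and irrational: "z \<notin> \<rat>"
  shows "\<exists>b c. \<forall>w. w = z \<or> poly (map_poly of_rat P) w = 0 \<longrightarrow> w\<^sup>2 + of_rat b * w + of_rat c = 0"
proof -
  let ?h = "map_poly (of_rat :: rat \<Rightarrow> complex)"
  interpret h: map_poly_inj_idom_hom "of_rat :: rat \<Rightarrow> complex" ..
  have P0: "P \<noteq> 0" using deg N by auto
  have "[:- z, 1:] dvd ?h P" using ord N by (meson dvd_power dvd_trans)
  then have Pz: "poly (?h P) z = 0" by (simp add: poly_eq_0_iff_dvd)
  \<comment> \<open>The minimal polynomial is taken as a nonzero rational polynomial of least degree
    vanishing at \<open>z\<close>; it is made monic only at the end, on division by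
    \<open>a0\<close>.\<close>
  define vanish where "vanish p \<longleftrightarrow> p \<noteq> 0 \<and> poly (?h p) z = 0" for p
  have "vanish P" using P0 Pz by (simp add: vanish_def)
  then obtain p where p: "vanish p" and min: "\<And>q. vanish q \<Longrightarrow> degree p \<le> degree q"
    using ex_has_least_nat[of vanish P degree] by blast
  then have p0: "p \<noteq> 0" and pz: "poly (?h p) z = 0" by (auto simp: vanish_def)
  have dvd: "p dvd q" if "poly (?h q) z = 0" for q
  proof (rule ccontr)
    assume "\<not> p dvd q"
    then have nz: "q mod p \<noteq> 0" by (simp add: dvd_eq_mod_eq_0)
    have "?h (q mod p) = ?h q - ?h (q div p) * ?h p"
      by (simp add: minus_div_mult_eq_mod flip: h.hom_mult h.hom_minus)
    then have "vanish (q mod p)" using that pz nz by (simp add: vanish_def)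
    moreover have "degree (q mod p) < degree p" using nz p0 degree_mod_less by blast
    ultimately show False using min by fastforce
  qed
  have deg_p: "degree p \<ge> 2"
  proof (rule ccontr)
    assume "\<not> degree p \<ge> 2"
    then have "degree p \<le> 1" by simp
    then have "p = [:coeff p 0, coeff p 1:]"
      by (intro poly_eqI) (auto simp: coeff_pCons coeff_eq_0 split: nat.splits)
    then obtain a b where ab: "p = [:a, b:]" by blast
    show False
    proof (cases "b = 0")
      case True
      then show False using pz p0 ab by simp
    next
      case False
      then have "z = of_rat (- a / b)" using pz ab
        by (simp add: of_rat_divide of_rat_minus field_simps eq_neg_iff_add_eq_0)
      then show False using irrational by simp
    qed
  qed
  have "e \<le> degree P" if "p ^ e dvd P" for e
  proof -
    have "e * 1 \<le> e * degree p" using deg_p by (intro mult_le_mono) auto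
    also have "\<dots> = degree (p ^ e)" using p0 by (simp add: degree_power_eq)
    also have "\<dots> \<le> degree P" using that P0 by (rule dvd_imp_degree_le)
    finally show ?thesis by simp
  qed
  then obtain e where "p ^ e dvd P" and max: "\<And>e'. p ^ e' dvd P \<Longrightarrow> e' \<le> e"
    using ex_has_greatest_nat[of "\<lambda>e. p ^ e dvd P" 0 "\<lambda>e. e" "Suc (degree P)"]
    by (auto simp: less_Suc_eq_le)
  then obtain q where q: "P = p ^ e * q" by blast
  have nq: "\<not> p dvd q"
  proof
    assume "p dvd q"
    then have "p ^ Suc e dvd P" unfolding q by (metis dvd_refl mult_dvd_mono power_Suc2)
    then show False using max by fastforce
  qed
  have Pe: "?h P = ?h p ^ e * ?h q" by (simp add: q h.hom_mult h.hom_power)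
  have nz: "?h P \<noteq> 0" "?h p \<noteq> 0" using P0 p0 by simp_all
  have qz: "poly (?h q) z \<noteq> 0" using nq dvd by blast
  \<comment> \<open>Separability: the derivative is nonzero of smaller degree, so by minimality it
    cannot vanish at \<open>z\<close>.\<close>
  have "pderiv p \<noteq> 0" using deg_p by (simp add: pderiv_eq_0_iff)
  have "degree (pderiv p) < degree p" using deg_p by (simp add: degree_pderiv)
  then have "poly (?h (pderiv p)) z \<noteq> 0"
    using min[of "pderiv p"] \<open>pderiv p \<noteq> 0\<close> by (auto simp: vanish_def)
  then have pd: "poly (pderiv (?h p)) z \<noteq> 0"
    by (simp add: of_rat_hom.map_poly_pderiv)
  have "Polynomial.order z (?h p) = 1"
  proof -
    have "Polynomial.order z (?h p) \<noteq> 0" using nz pz order_root by blast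
    moreover have "pderiv (?h p) \<noteq> 0" using pd by auto
    ultimately show ?thesis using pd order_pderiv2[of "?h p" z 0] by (simp add: order_0I)
  qed
  then have "Polynomial.order z (?h p ^ i) = i" for i
    using nz by (induction i) (simp_all add: order_mult)
  then have "Polynomial.order z (?h P) = e"
    using nz qz unfolding Pe by (subst order_mult) (auto simp: order_0I)
  moreover have "Polynomial.order z (?h P) \<ge> N" using ord nz by (simp add: order_divides)
  ultimately have eN: "e \<ge> N" by simp
  have q0: "q \<noteq> 0" using q P0 by auto
  have "2 * N = e * degree p + degree q"
    using p0 q0 by (simp add: q degree_mult_eq degree_power_eq flip: deg)
  moreover have "N * 2 \<le> e * degree p" using eN deg_p by (intro mult_le_mono) auto
  ultimately have "degree q = 0" and ep: "e * degree p = N * 2" by auto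
  have "degree p = 2"
  proof (rule ccontr)
    assume "degree p \<noteq> 2"
    then have "N * 2 < N * degree p" using N deg_p by simp
    also have "\<dots> \<le> e * degree p" using eN by simp
    finally show False using ep by simp
  qed
  obtain d where d: "q = [:d:]" using \<open>degree q = 0\<close> degree_eq_zeroE by blast
  then have "d \<noteq> 0" using q0 by simp
  have roots: "poly (?h p) w = 0" if "w = z \<or> poly (?h P) w = 0" for w
    using that pz \<open>d \<noteq> 0\<close> by (auto simp: Pe d poly_power)
  obtain c0 b0 a0 where abc: "p = [:c0, b0, a0:]" and a0: "a0 \<noteq> 0"
    using degree2_coeffs[OF \<open>degree p = 2\<close>] by metis
  have "w\<^sup>2 + of_rat (b0 / a0) * w + of_rat (c0 / a0) = 0" if "poly (?h p) w = 0" for w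
    using that a0 by (simp add: abc of_rat_divide field_simps power2_eq_square)
  then show ?thesis using roots by blast
qed

text \<open>The square of the adjacency matrix counts common neighbours. For an edge
  \<open>x y\<close>, the diagonal entry gives \<open>x\<close> degree \<open>- c\<close>, and the
  entry at \<open>x y\<close> gives \<open>- b\<close> common neighbours. Each neighbour of
  \<open>x\<close> other than \<open>y\<close> is adjacent to \<open>y\<close>, so the two counts
  differ by one.\<close>

lemma quadratic_adjacency_eq:
  fixes E :: "nat \<Rightarrow> nat \<Rightarrow> bool" and b c :: "'a :: linordered_idom"
  assumes sym: "\<And>i j. i < n \<Longrightarrow> j < n \<Longrightarrow> E i j \<Longrightarrow> E j i"
    and irrefl: "\<And>i. i < n \<Longrightarrow> \<not> E i i"
    and edge: "x < n" "y < n" "E x y"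
    and quad: "\<And>i j. i < n \<Longrightarrow> j < n \<Longrightarrow>
      (\<Sum>l<n. of_bool (E i l) * of_bool (E l j)) + b * of_bool (E i j) + c * of_bool (i = j) = 0"
  shows "b = 1 + c"
proof -
  have count: "(\<Sum>l<n. of_bool (E i l) * of_bool (E l j)) = (of_nat (card {l. l < n \<and> E i l \<and> E l j}) :: 'a)" for i j
  proof -
    have "(\<Sum>l<n. of_bool (E i l) * of_bool (E l j)) = (\<Sum>l<n. of_bool (E i l \<and> E l j) :: 'a)"
      by (simp add: of_bool_conj)
    also have "\<dots> = of_nat (card ({..<n} \<inter> {l. E i l \<and> E l j}))"
      by (simp add: sum_of_bool_eq)
    also have "{..<n} \<inter> {l. E i l \<and> E l j} = {l. l < n \<and> E i l \<and> E l j}" by auto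
    finally show ?thesis .
  qed
  \<comment> \<open>For distinct non-adjacent \<open>l\<close> and \<open>y\<close> the quadratic
    relation allows no common neighbour, yet \<open>x\<close> would be one.\<close>
  have adj: "E l y" if "l < n" "E x l" "l \<noteq> y" for l
  proof (rule ccontr)
    assume "\<not> E l y"
    then have "of_nat (card {m. m < n \<and> E l m \<and> E m y}) = (0::'a)"
      using quad[of l y] that edge by (simp add: count)
    then have "{m. m < n \<and> E l m \<and> E m y} = {}" by simp
    then show False using that edge sym by blast
  qed
  let ?C = "{l. l < n \<and> E x l \<and> E l y}"
  have "{l. l < n \<and> E x l \<and> E l x} = insert y ?C"
    using adj edge sym by blast
  moreover have "y \<notin> ?C" using irrefl edge by auto
  ultimately have "card {l. l < n \<and> E x l \<and> E l x} = Suc (card ?C)" by simp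
  moreover have "of_nat (card {l. l < n \<and> E x l \<and> E l x}) + c = 0"
    using quad[of x x] edge irrefl by (simp add: count)
  moreover have "x \<noteq> y" using irrefl edge by blast
  then have "of_nat (card ?C) + b = 0"
    using quad[of x y] edge by (simp add: count)
  ultimately show ?thesis by (simp add: algebra_simps eq_neg_iff_add_eq_0)
qed

section \<open>Characteristic polynomials and traces\<close>

text \<open>Both sides are obtained from the determinant of the block matrix \<open>[[t I, F], [G, I]]\<close>, eliminating
  either off-diagonal block.\<close>

lemma det_scalar_minus_mult_commute:
  fixes F G :: "'a :: idom mat"
  assumes F: "F \<in> carrier_mat n r" and G: "G \<in> carrier_mat r n"
  shows "det (t \<cdot>\<^sub>m 1\<^sub>m n - F * G) * t ^ r = t ^ n * det (t \<cdot>\<^sub>m 1\<^sub>m r - G * F)"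
proof -
  let ?L = "four_block_mat (t \<cdot>\<^sub>m 1\<^sub>m n) F G (1\<^sub>m r)"
  let ?R = "four_block_mat (1\<^sub>m n) (0\<^sub>m n r) (- G) (1\<^sub>m r)"
  let ?S = "four_block_mat (1\<^sub>m n) (- F) (0\<^sub>m r n) (t \<cdot>\<^sub>m 1\<^sub>m r)"
  have L: "?L \<in> carrier_mat (n + r) (n + r)" and R: "?R \<in> carrier_mat (n + r) (n + r)"
    and S: "?S \<in> carrier_mat (n + r) (n + r)"
    by (intro four_block_carrier_mat; simp)+
  have tF: "(t \<cdot>\<^sub>m 1\<^sub>m n) * F = t \<cdot>\<^sub>m F" "F * (t \<cdot>\<^sub>m 1\<^sub>m r) = t \<cdot>\<^sub>m F"
    using F by (simp_all add: mult_smult_assoc_mat[of _ n n] mult_smult_distrib[of _ n r _ r])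
  have "?L * ?R = four_block_mat (t \<cdot>\<^sub>m 1\<^sub>m n - F * G) F (0\<^sub>m r n) (1\<^sub>m r)"
    by (subst mult_four_block_mat[of _ n n _ r _ r _ _ n _ r])
       (use F G in \<open>auto intro!: arg_cong2[where f = "\<lambda>x y. four_block_mat x F y (1\<^sub>m r)"] eq_matI\<close>)
  then have "det ?L * det ?R = det (four_block_mat (t \<cdot>\<^sub>m 1\<^sub>m n - F * G) F (0\<^sub>m r n) (1\<^sub>m r))"
    by (metis det_mult[OF L R])
  also have "\<dots> = det (t \<cdot>\<^sub>m 1\<^sub>m n - F * G) * det (1\<^sub>m r :: 'a mat)"
    by (rule det_four_block_mat_lower_left_zero[of _ n _ r]) (use F G in auto)
  also have "det ?R = 1"
    by (subst det_four_block_mat_upper_right_zero[of _ n _ r]) (use G in auto)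
  finally have 1: "det ?L = det (t \<cdot>\<^sub>m 1\<^sub>m n - F * G)" by simp
  have "?L * ?S = four_block_mat (t \<cdot>\<^sub>m 1\<^sub>m n) (0\<^sub>m n r) G (t \<cdot>\<^sub>m 1\<^sub>m r - G * F)"
    by (subst mult_four_block_mat[of _ n n _ r _ r _ _ n _ r])
       (use F G tF in \<open>auto intro!: arg_cong2[where f = "\<lambda>x y. four_block_mat (t \<cdot>\<^sub>m 1\<^sub>m n) x G y"] eq_matI\<close>)
  then have "det ?L * det ?S = det (four_block_mat (t \<cdot>\<^sub>m 1\<^sub>m n) (0\<^sub>m n r) G (t \<cdot>\<^sub>m 1\<^sub>m r - G * F))"
    by (metis det_mult[OF L S])
  also have "\<dots> = det (t \<cdot>\<^sub>m 1\<^sub>m n) * det (t \<cdot>\<^sub>m 1\<^sub>m r - G * F)"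
    by (rule det_four_block_mat_upper_right_zero[of _ n _ r]) (use F G in auto)
  also have "det ?S = det (1\<^sub>m n) * det (t \<cdot>\<^sub>m 1\<^sub>m r)"
    by (rule det_four_block_mat_lower_left_zero[of _ n _ r]) (use F in auto)
  finally show ?thesis by (simp add: 1 det_smult)
qed

text \<open>The characteristic matrix of \<open>A\<close> is \<open>[:k, 1:]\<close> times the
  identity minus the product of the lifted factors \<open>F\<close> and \<open>G\<close>. Exchanging
  the factors leaves a determinant of size \<open>r\<close> and splits off the power of
  \<open>[:k, 1:]\<close>.\<close>

lemma power_dvd_char_poly_low_rank:
  fixes A F G :: "'a :: idom mat"
  assumes F: "F \<in> carrier_mat n r" and G: "G \<in> carrier_mat r n"
    and A: "A \<in> carrier_mat n n" and AFG: "k \<cdot>\<^sub>m 1\<^sub>m n + A = F * G"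
  shows "[:k, 1:] ^ (n - r) dvd char_poly A"
proof (cases "r \<le> n")
  case True
  let ?c = "map_mat (\<lambda>a. [:a:])"
  have "[:k, 1:] \<cdot>\<^sub>m 1\<^sub>m n - ?c (k \<cdot>\<^sub>m 1\<^sub>m n + A) = char_poly_matrix A"
    using A by (intro eq_matI) (auto simp: char_poly_matrix_def)
  then have "char_poly_matrix A = [:k, 1:] \<cdot>\<^sub>m 1\<^sub>m n - ?c (F * G)" by (simp add: AFG)
  also have "?c (F * G) = ?c F * ?c G" by (rule map_poly_mult(1)[OF F G])
  finally have "char_poly A = det ([:k, 1:] \<cdot>\<^sub>m 1\<^sub>m n - ?c F * ?c G)"
    by (simp add: char_poly_def)
  then have "char_poly A * [:k, 1:] ^ r = [:k, 1:] ^ n * det ([:k, 1:] \<cdot>\<^sub>m 1\<^sub>m r - ?c G * ?c F)"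
    using det_scalar_minus_mult_commute[of "?c F" n r "?c G" "[:k, 1:]"] F G by simp
  also have "[:k, 1:] ^ n = [:k, 1:] ^ (n - r) * [:k, 1:] ^ r"
    using True by (simp flip: power_add)
  \<comment> \<open>The nonzero factor \<open>[:k, 1:] ^ r\<close> is cancelled.\<close>
  finally have "char_poly A = [:k, 1:] ^ (n - r) * det ([:k, 1:] \<cdot>\<^sub>m 1\<^sub>m r - ?c G * ?c F)"
    by (simp add: mult.assoc mult.left_commute[of _ "[:k, 1:] ^ r"])
  then show ?thesis by (rule dvdI)
qed simp

lemma trace_mult_commute:
  fixes X Y :: "'a :: comm_semiring_0 mat"
  assumes "X \<in> carrier_mat n m" "Y \<in> carrier_mat m n"
  shows "(\<Sum>i<n. (X * Y) $$ (i, i)) = (\<Sum>i<m. (Y * X) $$ (i, i))"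
proof -
  have "(\<Sum>i<n. (X * Y) $$ (i, i)) = (\<Sum>i<n. \<Sum>j<m. X $$ (i, j) * Y $$ (j, i))"
    using assms by (auto simp: scalar_prod_def atLeast0LessThan)
  also have "\<dots> = (\<Sum>j<m. \<Sum>i<n. X $$ (i, j) * Y $$ (j, i))" by (rule sum.swap)
  also have "\<dots> = (\<Sum>i<m. (Y * X) $$ (i, i))"
    using assms by (auto simp: scalar_prod_def atLeast0LessThan mult.commute)
  finally show ?thesis .
qed

text \<open>In a Schur form of \<open>A\<close> the diagonal holds the eigenvalues, so the quadratic
  expression becomes strictly upper triangular and its square has trace zero. For a real symmetric
  \<open>B\<close> this trace is the sum of the squared entries, which forces \<open>B\<close> to be
  zero.\<close>

lemma trace_square_quadratic_eq_0:
  fixes A :: "complex mat"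
  assumes A: "A \<in> carrier_mat n n"
    and roots: "\<And>w. poly (char_poly A) w = 0 \<Longrightarrow> w\<^sup>2 + b * w + c = 0"
  defines "B \<equiv> A * A + b \<cdot>\<^sub>m A + c \<cdot>\<^sub>m 1\<^sub>m n"
  shows "(\<Sum>i<n. (B * B) $$ (i, i)) = 0"
proof -
  obtain es where es: "char_poly A = (\<Prod>a\<leftarrow>es. [:- a, 1:])"
    using char_poly_factorized[OF A] by blast
  then obtain T where T: "T \<in> carrier_mat n n" "upper_triangular T" "similar_mat A T"
    using schur_decomposition_exists[OF A] by blast
  then obtain P Q where "similar_mat_wit A T P Q" unfolding similar_mat_def by blast
  from similar_mat_witD2[OF A this] have PQ: "P * Q = 1\<^sub>m n" "Q * P = 1\<^sub>m n"
    and APTQ: "A = P * T * Q" and P: "P \<in> carrier_mat n n" and Q: "Q \<in> carrier_mat n n" by auto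
  have conj_mult: "(P * X * Q) * (P * Y * Q) = P * (X * Y) * Q"
    if X: "X \<in> carrier_mat n n" and Y: "Y \<in> carrier_mat n n" for X Y
  proof -
    have "(P * X * Q) * (P * Y * Q) = P * X * (Q * P) * Y * Q"
      using P Q X Y by (simp add: assoc_mult_mat[of _ n n _ n _ n])
    then show ?thesis using P Q X Y by (simp add: PQ assoc_mult_mat[of _ n n _ n _ n])
  qed
  define R where "R = T * T + b \<cdot>\<^sub>m T + c \<cdot>\<^sub>m 1\<^sub>m n"
  have R: "R \<in> carrier_mat n n" using T by (simp add: R_def)
  have "P * R * Q = P * (T * T) * Q + b \<cdot>\<^sub>m (P * T * Q) + c \<cdot>\<^sub>m (P * Q)"
    using P Q T(1) unfolding R_def
    by (simp add: mult_add_distrib_mat[of _ n n _ n] add_mult_distrib_mat[of _ n n _ _ n]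
        mult_smult_distrib[of _ n n _ n] mult_smult_assoc_mat[of _ n n _ n])
  then have BR: "B = P * R * Q"
    using conj_mult[OF T(1) T(1)] by (simp add: B_def PQ flip: APTQ)
  have T_diag: "(T $$ (i, i))\<^sup>2 + b * T $$ (i, i) + c = 0" if "i < n" for i
  proof -
    have "char_poly A = (\<Prod>a\<leftarrow>diag_mat T. [:- a, 1:])"
      using char_poly_similar[OF T(3)] char_poly_upper_triangular[OF T(1,2)] by simp
    moreover have "T $$ (i, i) \<in> set (diag_mat T)" using that T(1) by (auto simp: diag_mat_def)
    ultimately have "poly (char_poly A) (T $$ (i, i)) = 0"
      by (auto simp: poly_prod_list prod_list_zero_iff)
    then show ?thesis by (rule roots)
  qed
  have R0: "R $$ (i, j) = 0" if "j \<le> i" "i < n" for i j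
  proof -
    have "(T * T) $$ (i, j) = (\<Sum>l<n. T $$ (i, l) * T $$ (l, j))"
      using that T(1) by (simp add: scalar_prod_def atLeast0LessThan)
    \<comment> \<open>Triangularity kills \<open>T $$ (i, l)\<close> for \<open>l < i\<close>, and
      \<open>T $$ (l, j)\<close> for \<open>l > i\<close> because \<open>j \<le> i\<close>.\<close>
    also have "\<dots> = (\<Sum>l<n. if l = i then T $$ (i, i) * T $$ (i, j) else 0)"
    proof (intro sum.cong refl)
      fix l assume "l \<in> {..<n}"
      then show "T $$ (i, l) * T $$ (l, j) = (if l = i then T $$ (i, i) * T $$ (i, j) else 0)"
        using upper_triangularD[OF T(2), of l i] upper_triangularD[OF T(2), of j l] that T(1)
        by (cases l i rule: linorder_cases) auto
    qed
    finally have "(T * T) $$ (i, j) = T $$ (i, i) * T $$ (i, j)" using that by simp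
    then show ?thesis
      using that T_diag[of i] upper_triangularD[OF T(2), of j i] T(1)
      by (cases "i = j") (auto simp: R_def power2_eq_square)
  qed
  have "(\<Sum>i<n. (B * B) $$ (i, i)) = (\<Sum>i<n. (P * (R * R) * Q) $$ (i, i))"
    using conj_mult[OF R R] by (simp add: BR)
  also have "\<dots> = (\<Sum>i<n. (Q * (P * (R * R))) $$ (i, i))"
    by (rule trace_mult_commute) (use P Q R in auto)
  also have "Q * (P * (R * R)) = R * R"
    using P Q R by (simp add: PQ(2) flip: assoc_mult_mat[of Q n n P n "R * R" n])
  also have "(\<Sum>i<n. (R * R) $$ (i, i)) = (\<Sum>i<n. \<Sum>l<n. R $$ (i, l) * R $$ (l, i))"
    using R by (simp add: scalar_prod_def atLeast0LessThan)
  also have "\<dots> = 0"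
    by (intro sum.neutral ballI) (metis R0 lessThan_iff linear mult_zero_left mult_zero_right)
  finally show ?thesis .
qed

section \<open>Integrality of the diagonal value\<close>

lemma of_real_of_rat: "of_real (of_rat r) = (of_rat r :: 'a :: real_field)"
  by (induction r) (simp add: of_rat_rat)

text \<open>As a root of a monic integral polynomial, \<open>- k\<close> is an algebraic integer, so
  rationality is enough. The condition on \<open>k\<close> excludes the graph without edges, whose
  matrix would have full rank.\<close>

lemma low_rank_diagonal_in_Ints:
  fixes k :: real and N :: nat and E :: "nat \<Rightarrow> nat \<Rightarrow> bool"
  assumes N: "N > 0" and k: "k \<noteq> 0"
    and sym: "\<And>i j. i < 2 * N \<Longrightarrow> j < 2 * N \<Longrightarrow> E i j \<Longrightarrow> E j i"
    and irrefl: "\<And>i. i < 2 * N \<Longrightarrow> \<not> E i i"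
    and fact: "\<And>i j. i < 2 * N \<Longrightarrow> j < 2 * N \<Longrightarrow>
      (if i = j then k else of_bool (E i j)) = (\<Sum>a<N. p a i * q a j)"
  shows "k \<in> \<int>"
proof -
  define n where "n = 2 * N"
  define z where "z = - complex_of_real k"
  define AZ :: "int mat" where "AZ = mat n n (\<lambda>(i,j). of_bool (E i j))"
  define A :: "complex mat" where "A = map_mat of_int AZ"
  define P :: "rat poly" where "P = map_poly of_int (char_poly AZ)"
  have AZ: "AZ \<in> carrier_mat n n" and A: "A \<in> carrier_mat n n" by (auto simp: AZ_def A_def)
  have A_entry: "A $$ (i, j) = of_bool (E i j)" if "i < n" "j < n" for i j
    using that by (simp add: A_def AZ_def)
  have deg: "degree (char_poly AZ) = n" "coeff (char_poly AZ) n = 1"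
    using degree_monic_char_poly[OF AZ] by auto
  have chA: "char_poly A = map_poly of_int (char_poly AZ)"
    unfolding A_def by (rule of_int_hom.char_poly_hom[OF AZ])
  have hP: "map_poly of_rat P = char_poly A"
    unfolding P_def chA by (subst map_poly_map_poly) (auto simp: o_def)
  have dvd: "[:- z, 1:] ^ N dvd char_poly A"
  proof -
    let ?F = "mat n N (\<lambda>(i,a). complex_of_real (p a i))"
    let ?G = "mat N n (\<lambda>(a,j). complex_of_real (q a j))"
    have "complex_of_real k \<cdot>\<^sub>m 1\<^sub>m n + A = ?F * ?G"
    proof (rule eq_matI)
      fix i j assume "i < dim_row (?F * ?G)" "j < dim_col (?F * ?G)"
      then have ij: "i < n" "j < n" by auto
      have "(complex_of_real k \<cdot>\<^sub>m 1\<^sub>m n + A) $$ (i, j) = complex_of_real (if i = j then k else of_bool (E i j))"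
        using ij A irrefl by (auto simp: A_entry n_def)
      also have "\<dots> = complex_of_real (\<Sum>a<N. p a i * q a j)"
        using fact ij by (simp only: n_def)
      also have "\<dots> = (?F * ?G) $$ (i, j)"
        using ij by (simp add: scalar_prod_def atLeast0LessThan)
      finally show "(complex_of_real k \<cdot>\<^sub>m 1\<^sub>m n + A) $$ (i, j) = (?F * ?G) $$ (i, j)" .
    qed (use A in auto)
    then have "[:complex_of_real k, 1:] ^ (n - N) dvd char_poly A"
      by (intro power_dvd_char_poly_low_rank[of ?F n N ?G A]) (use A in auto)
    then show ?thesis by (simp add: z_def n_def)
  qed
  have "[:- z, 1:] dvd char_poly A" using dvd N by (meson dvd_power dvd_trans)
  then have root: "poly (char_poly A) z = 0" by (simp add: poly_eq_0_iff_dvd)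
  have "z \<in> \<rat>"
  proof (rule ccontr)
    assume "z \<notin> \<rat>"
    moreover have "degree P = 2 * N" by (simp add: P_def deg n_def)
    ultimately obtain b c where bc:
      "\<And>w. w = z \<or> poly (char_poly A) w = 0 \<Longrightarrow> w\<^sup>2 + of_rat b * w + of_rat c = 0"
      using quadratic_minimal_polynomial_if_large_order[of P N z] N dvd unfolding hP by blast
    define B where "B = A * A + of_rat b \<cdot>\<^sub>m A + of_rat c \<cdot>\<^sub>m 1\<^sub>m n"
    \<comment> \<open>The entries of \<open>B\<close> are real; \<open>\<beta>\<close> records them
      as such, so that a vanishing sum of squares forces every entry to vanish.\<close>
    define \<beta> :: "nat \<Rightarrow> nat \<Rightarrow> real" where "\<beta> i j = (\<Sum>l<n. of_bool (E i l) * of_bool (E l j))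
      + of_rat b * of_bool (E i j) + of_rat c * of_bool (i = j)" for i j
    have E_comm: "E i j \<longleftrightarrow> E j i" if "i < n" "j < n" for i j
      using sym that n_def by blast
    have \<beta>_comm: "\<beta> i j = \<beta> j i" if "i < n" "j < n" for i j
    proof -
      have "(\<Sum>l<n. of_bool (E i l) * of_bool (E l j)) = (\<Sum>l<n. of_bool (E j l) * of_bool (E l i) :: real)"
        using that by (intro sum.cong refl) (auto simp: E_comm)
      then show ?thesis using that by (auto simp: \<beta>_def E_comm)
    qed
    have B: "B \<in> carrier_mat n n" using A by (simp add: B_def)
    have B_entry: "B $$ (i, j) = complex_of_real (\<beta> i j)" if "i < n" "j < n" for i j
      using that A by (auto simp: B_def \<beta>_def A_entry scalar_prod_def atLeast0LessThan
          of_real_of_rat intro!: sum.cong)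
    have "complex_of_real (\<Sum>i<n. \<Sum>j<n. (\<beta> i j)\<^sup>2) = (\<Sum>i<n. (B * B) $$ (i, i))"
      using B by (auto simp: scalar_prod_def atLeast0LessThan B_entry \<beta>_comm power2_eq_square
          intro!: sum.cong)
    also have "\<dots> = 0"
      unfolding B_def by (rule trace_square_quadratic_eq_0[OF A]) (use bc in blast)
    finally have "(\<Sum>i<n. \<Sum>j<n. (\<beta> i j)\<^sup>2) = 0"
      by (simp only: of_real_eq_0_iff)
    then have \<beta>0: "\<beta> i j = 0" if "i < n" "j < n" for i j
      using that by (simp add: sum_nonneg_eq_0_iff sum_nonneg)
    \<comment> \<open>Without edges the matrix is \<open>k\<close> times the identity of size
      \<open>2 * N\<close>, and the trace inequality with rank bound \<open>N\<close> fails for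
      \<open>k \<noteq> 0\<close>.\<close>
    have "\<exists>x<n. \<exists>y<n. E x y"
    proof (rule ccontr)
      assume "\<not> ?thesis"
      then have "(if i = j then k else 0) = (\<Sum>a<N. p a i * q a j)" if "i < n" "j < n" for i j
        using fact[of i j] that by (cases "i = j") (auto simp: n_def)
      then have "(\<Sum>i<n. if i = i then k else 0)\<^sup>2 \<le>
          real N * (\<Sum>i<n. \<Sum>j<n. (if i = j then k else 0)\<^sup>2)"
        by (rule square_trace_le_rank_mult_frobenius)
      also have "(\<Sum>i<n. \<Sum>j<n. (if i = j then k else 0)\<^sup>2) = real n * k\<^sup>2"
        by (simp add: if_distrib[of "\<lambda>x. x\<^sup>2"] cong: if_cong)
      finally have "4 * ((real N * k)\<^sup>2) \<le> 2 * (real N * k)\<^sup>2"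
        by (simp add: n_def power2_eq_square algebra_simps)
      then show False using N k by simp
    qed
    then obtain x y where "x < n" "y < n" "E x y" by blast
    then have "(of_rat b :: real) = 1 + of_rat c"
      using \<beta>0 E_comm irrefl unfolding \<beta>_def
      by (intro quadratic_adjacency_eq[of n E x y]) (auto simp: n_def)
    then have "complex_of_real (of_rat b) = complex_of_real (1 + of_rat c)" by simp
    then have "(of_rat b :: complex) = 1 + of_rat c" by (simp add: of_real_of_rat)
    then have "(z + 1) * (z + of_rat c) = 0"
      using bc[of z] by (simp add: algebra_simps power2_eq_square)
    then have "z = - 1 \<or> z = - of_rat c" by (auto simp: eq_neg_iff_add_eq_0)
    then show False using \<open>z \<notin> \<rat>\<close> by auto
  qed
  moreover have "algebraic_int z"
    unfolding algebraic_int.simps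
    by (intro exI[of _ "char_poly A"]) (use root deg in \<open>auto simp: chA\<close>)
  ultimately have "z \<in> \<int>" by (rule rational_algebraic_int_is_int[rotated])
  then show "k \<in> \<int>" unfolding z_def by simp
qed

section \<open>The polynomial space\<close>

text \<open>The span of a finite set of functions with explicit coefficients, from which a rank
  factorization is read off in \<open>lincomb_family_factorization\<close>.\<close>

definition lincomb :: "('a \<Rightarrow> real) set \<Rightarrow> ('a \<Rightarrow> real) \<Rightarrow> bool" where
  "lincomb T f \<longleftrightarrow> (\<exists>c. \<forall>y. f y = (\<Sum>g\<in>T. c g * g y))"

lemma lincomb_add: "lincomb T f \<Longrightarrow> lincomb T g \<Longrightarrow> lincomb T (\<lambda>y. f y + g y)"
  unfolding lincomb_def
proof (elim exE)
  fix c d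
  assume "\<forall>y. f y = (\<Sum>g\<in>T. c g * g y)" "\<forall>y. g y = (\<Sum>g\<in>T. d g * g y)"
  then show "\<exists>c. \<forall>y. f y + g y = (\<Sum>g\<in>T. c g * g y)"
    by (intro exI[of _ "\<lambda>g. c g + d g"]) (simp add: algebra_simps sum.distrib)
qed

lemma lincomb_scale: "lincomb T f \<Longrightarrow> lincomb T (\<lambda>y. r * f y)"
  unfolding lincomb_def
proof (elim exE)
  fix c assume "\<forall>y. f y = (\<Sum>g\<in>T. c g * g y)"
  then show "\<exists>c. \<forall>y. r * f y = (\<Sum>g\<in>T. c g * g y)"
    by (intro exI[of _ "\<lambda>g. r * c g"]) (simp add: sum_distrib_left mult.assoc)
qed

lemma lincomb_sum: "(\<And>i. i \<in> I \<Longrightarrow> lincomb T (f i)) \<Longrightarrow> lincomb T (\<lambda>y. \<Sum>i\<in>I. f i y)"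
proof (induction I rule: infinite_finite_induct)
  case (insert i I)
  then show ?case using lincomb_add[of T "f i" "\<lambda>y. \<Sum>i\<in>I. f i y"] by simp
qed (auto simp: lincomb_def intro!: exI[of _ "\<lambda>_. 0"])

lemma lincomb_base: "finite T \<Longrightarrow> f \<in> T \<Longrightarrow> lincomb T f"
  unfolding lincomb_def
  by (intro exI[of _ "\<lambda>g. of_bool (g = f)"]) (simp add: of_bool_def if_distrib[of "\<lambda>x. x * _"] cong: if_cong)

section \<open>Counting and multiplying monomials\<close>

definition bounded_multisets :: "'b set \<Rightarrow> nat \<Rightarrow> 'b multiset set" where
  "bounded_multisets B t = {m. set_mset m \<subseteq> B \<and> size m \<le> t}"

lemma bounded_multisets_insert_Suc:
  "bounded_multisets (insert a B) (Suc t) \<subseteq>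
    bounded_multisets B (Suc t) \<union> add_mset a ` bounded_multisets (insert a B) t"
proof
  fix m assume m: "m \<in> bounded_multisets (insert a B) (Suc t)"
  show "m \<in> bounded_multisets B (Suc t) \<union> add_mset a ` bounded_multisets (insert a B) t"
  proof (cases "a \<in># m")
    case True
    then obtain m' where "m = add_mset a m'" by (metis insert_DiffM)
    then show ?thesis using m by (auto simp: bounded_multisets_def)
  qed (use m in \<open>auto simp: bounded_multisets_def\<close>)
qed

text \<open>Multisets of basis vectors encode monomials. Such a multiset either avoids
  \<open>a\<close> or arises by adding one copy of \<open>a\<close> to a smaller one, and the bound
  follows from Pascal's rule.\<close>

lemma card_bounded_multisets_le:
  assumes "finite B"
  shows "finite (bounded_multisets B t) \<and> card (bounded_multisets B t) \<le> (card B + t) choose t"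
  using assms
proof (induction B arbitrary: t rule: finite_induct)
  case empty
  have "bounded_multisets {} t = ({{#}} :: 'a multiset set)" by (auto simp: bounded_multisets_def)
  then show ?case by simp
next
  case (insert a B)
  show ?case
  proof (induction t)
    case 0
    have "bounded_multisets (insert a B) 0 = {{#}}" by (auto simp: bounded_multisets_def)
    then show ?case by simp
  next
    case (Suc t)
    let ?L = "bounded_multisets B (Suc t)" and ?R = "add_mset a ` bounded_multisets (insert a B) t"
    have fin: "finite (?L \<union> ?R)" using insert.IH Suc.IH by auto
    note sub = bounded_multisets_insert_Suc[of a B t]
    have "card (bounded_multisets (insert a B) (Suc t)) \<le> card (?L \<union> ?R)"
      using fin sub by (rule card_mono)
    also have "\<dots> \<le> card ?L + card ?R" by (rule card_Un_le)
    also have "\<dots> \<le> ((card B + Suc t) choose Suc t) + ((card (insert a B) + t) choose t)"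
      using insert.IH[of "Suc t"] Suc.IH by (intro add_mono order_trans[OF card_image_le]) auto
    also have "\<dots> = (card (insert a B) + Suc t) choose Suc t"
      using insert.hyps by simp
    finally show ?case using fin sub finite_subset by blast
  qed
qed

definition monomial_fun :: "'a::euclidean_space multiset \<Rightarrow> 'a \<Rightarrow> real" where
  "monomial_fun m y = (\<Prod>b\<in>#m. y \<bullet> b)"

lemma monomial_fun_add [simp]: "monomial_fun (add_mset b m) y = (y \<bullet> b) * monomial_fun m y"
  by (simp add: monomial_fun_def)

text \<open>A product of \<open>t\<close> affine functions of \<open>1, y, |y|\<^sup>2\<close> is homogeneous of degree \<open>t\<close> in these \<open>d + 2\<close>
  functions. Since \<open>|y|\<^sup>2 \<cdot> 1 = \<Sum>b. (y \<bullet> b)\<^sup>2\<close>, only the monomials without the factor \<open>|y|\<^sup>2\<close> (first set)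
  or without the factor \<open>1\<close> (second set) are needed.\<close>

definition sphere_monomials :: "nat \<Rightarrow> ('a::euclidean_space \<Rightarrow> real) set" where
  "sphere_monomials t = monomial_fun ` bounded_multisets Basis t \<union>
     (\<lambda>m y. (y \<bullet> y) ^ (t - size m) * monomial_fun m y) ` {m \<in> bounded_multisets Basis t. size m < t}"

lemma finite_sphere_monomials: "finite (sphere_monomials t)"
  by (simp add: sphere_monomials_def card_bounded_multisets_le)

text \<open>Size below \<open>Suc t\<close> means size at most \<open>t\<close>, so the two sets
  give the two binomials. Their sum is the \<open>N\<close> of the theorem for
  \<open>s = Suc (Suc t)\<close>.\<close>

lemma card_sphere_monomials_le:
  "card (sphere_monomials (Suc t) :: ('a::euclidean_space \<Rightarrow> real) set) \<le>
    ((DIM('a) + Suc t) choose Suc t) + ((DIM('a) + t) choose t)"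
proof -
  have eq: "{m \<in> bounded_multisets Basis (Suc t). size m < Suc t} = bounded_multisets (Basis :: 'a set) t"
    by (auto simp: bounded_multisets_def)
  show ?thesis
    unfolding sphere_monomials_def eq
    by (intro order_trans[OF card_Un_le] add_mono order_trans[OF card_image_le])
       (use card_bounded_multisets_le[of "Basis :: 'a set"] in \<open>blast intro: finite_Basis\<close>)+
qed

lemma lincomb_monomial:
  assumes "set_mset m \<subseteq> Basis" "size m \<le> t"
  shows "lincomb (sphere_monomials t) (monomial_fun m)"
  using assms by (intro lincomb_base finite_sphere_monomials)
    (auto simp: sphere_monomials_def bounded_multisets_def)

lemma lincomb_norm_monomial:
  assumes "set_mset m \<subseteq> Basis" "size m < t"
  shows "lincomb (sphere_monomials t) (\<lambda>y. (y \<bullet> y) ^ (t - size m) * monomial_fun m y)"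
  using assms by (intro lincomb_base finite_sphere_monomials)
    (auto simp: sphere_monomials_def bounded_multisets_def)

text \<open>This relation trades a factor \<open>y \<bullet> y\<close> for two extra degrees in the
  coordinates.\<close>

lemma inner_self_mult_monomial:
  "(y \<bullet> y) * monomial_fun m y = (\<Sum>b\<in>Basis. monomial_fun (add_mset b (add_mset b m)) y)"
  by (simp add: euclidean_inner[of y y] sum_distrib_right mult.assoc)

text \<open>Passing from \<open>t\<close> to \<open>Suc t\<close> multiplies by one of the
  homogeneous generators 1, \<open>y \<bullet> b\<close> and \<open>y \<bullet> y\<close>. Whenever
  both 1 and \<open>y \<bullet> y\<close> would occur, the pair is replaced by the sum of the
  squared coordinates.\<close>

lemma sphere_monomials_mult:
  fixes g :: "'a::euclidean_space \<Rightarrow> real"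
  assumes g: "g \<in> sphere_monomials t"
  shows "lincomb (sphere_monomials (Suc t)) g"
    and "b \<in> Basis \<Longrightarrow> lincomb (sphere_monomials (Suc t)) (\<lambda>y. (y \<bullet> b) * g y)"
    and "lincomb (sphere_monomials (Suc t)) (\<lambda>y. (y \<bullet> y) * g y)"
proof -
  let ?L = "lincomb (sphere_monomials (Suc t)) :: ('a \<Rightarrow> real) \<Rightarrow> bool"
  have "?L g \<and> (b \<in> Basis \<longrightarrow> ?L (\<lambda>y. (y \<bullet> b) * g y)) \<and> ?L (\<lambda>y. (y \<bullet> y) * g y)"
    using g unfolding sphere_monomials_def[of t]
  proof (elim UnE imageE)
    fix m :: "'a multiset"
    assume gm: "g = monomial_fun m" and "m \<in> bounded_multisets Basis t"
    then have m: "set_mset m \<subseteq> Basis" "size m \<le> t" by (auto simp: bounded_multisets_def)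
    have "?L (\<lambda>y. (y \<bullet> y) * monomial_fun m y)"
    \<comment> \<open>At full degree there is no factor 1 to trade, and the product lies in the
      second set; otherwise the expansion has degree at most \<open>Suc t\<close>.\<close>
    proof (cases "size m = t")
      case True
      then show ?thesis using lincomb_norm_monomial[of m "Suc t"] m by simp
    next
      case False
      then show ?thesis
        using m unfolding inner_self_mult_monomial by (intro lincomb_sum lincomb_monomial) auto
    qed
    moreover have "?L (\<lambda>y. (y \<bullet> b) * monomial_fun m y)" if "b \<in> Basis"
      using lincomb_monomial[of "add_mset b m" "Suc t"] m that by (simp flip: monomial_fun_add)
    moreover have "?L (monomial_fun m)" using m by (intro lincomb_monomial) auto
    ultimately show ?thesis by (simp add: gm)
  next
    fix m :: "'a multiset"
    assume gm: "g = (\<lambda>y. (y \<bullet> y) ^ (t - size m) * monomial_fun m y)"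
      and "m \<in> {m \<in> bounded_multisets Basis t. size m < t}"
    then have m: "set_mset m \<subseteq> Basis" "size m < t" by (auto simp: bounded_multisets_def)
    \<comment> \<open>The new factor 1 is traded against one \<open>y \<bullet> y\<close>. If
      \<open>Suc (size m) = t\<close>, no power of \<open>y \<bullet> y\<close> remains and the
      terms lie in the first set.\<close>
    have expand: "g y = (\<Sum>b\<in>Basis. (y \<bullet> y) ^ (Suc t - size (add_mset b (add_mset b m))) *
        monomial_fun (add_mset b (add_mset b m)) y)" for y
    proof -
      have "t - size m = Suc (t - Suc (size m))" using m by simp
      then have "g y = (y \<bullet> y) ^ (t - Suc (size m)) * ((y \<bullet> y) * monomial_fun m y)"
        by (simp add: gm)
      then show ?thesis unfolding inner_self_mult_monomial by (simp add: sum_distrib_left)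
    qed
    have "?L (\<lambda>y. (y \<bullet> y) ^ (Suc t - size (add_mset b (add_mset b m))) *
        monomial_fun (add_mset b (add_mset b m)) y)" if b: "b \<in> Basis" for b
    proof (cases "Suc (size m) = t")
      case True
      then show ?thesis
        using lincomb_monomial[of "add_mset b (add_mset b m)" "Suc t"] m b by (simp del: monomial_fun_add)
    next
      case False
      then show ?thesis using m b by (intro lincomb_norm_monomial) auto
    qed
    then have "?L g" unfolding expand[abs_def] by (rule lincomb_sum)
    moreover have "?L (\<lambda>y. (y \<bullet> b) * g y)" if "b \<in> Basis"
      using lincomb_norm_monomial[of "add_mset b m" "Suc t"] m that by (simp add: gm mult_ac)
    moreover have "?L (\<lambda>y. (y \<bullet> y) * g y)"
      using lincomb_norm_monomial[of m "Suc t"] m by (simp add: gm Suc_diff_le mult.assoc)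
    ultimately show ?thesis by simp
  qed
  then show "?L g" "b \<in> Basis \<Longrightarrow> ?L (\<lambda>y. (y \<bullet> b) * g y)" "?L (\<lambda>y. (y \<bullet> y) * g y)"
    by blast+
qed

text \<open>For fixed \<open>x\<close>, each factor is an affine function of the coordinates of
  \<open>y\<close> and of \<open>y \<bullet> y\<close>, so each new factor raises the degree by
  one.\<close>

lemma lincomb_prod_dist:
  fixes x :: "'a::euclidean_space"
  assumes "finite J"
  shows "lincomb (sphere_monomials (card J)) (\<lambda>y. \<Prod>j\<in>J. c j - d j * (dist x y)\<^sup>2)"
  using assms
proof (induction J rule: finite_induct)
  case empty
  then show ?case using lincomb_monomial[of "{#}" 0] by (simp add: monomial_fun_def[abs_def])
next
  case (insert j J)
  let ?t = "card J"
  let ?L = "lincomb (sphere_monomials (Suc ?t)) :: ('a \<Rightarrow> real) \<Rightarrow> bool"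
  obtain w where w: "\<And>y. (\<Prod>j\<in>J. c j - d j * (dist x y)\<^sup>2) = (\<Sum>g\<in>sphere_monomials ?t. w g * g y)"
    using insert.IH unfolding lincomb_def by blast
  have dist_eq: "c j - d j * (dist x y)\<^sup>2 = (c j - d j * (x \<bullet> x)) + (\<Sum>b\<in>Basis. 2 * d j * (x \<bullet> b) * (y \<bullet> b)) - d j * (y \<bullet> y)" for y
  proof -
    have "(dist x y)\<^sup>2 = x \<bullet> x - 2 * (x \<bullet> y) + y \<bullet> y"
      by (simp add: dist_norm power2_norm_eq_inner inner_diff inner_commute)
    also have "x \<bullet> y = (\<Sum>b\<in>Basis. (x \<bullet> b) * (y \<bullet> b))" by (rule euclidean_inner)
    finally have "(dist x y)\<^sup>2 = x \<bullet> x - 2 * (\<Sum>b\<in>Basis. (x \<bullet> b) * (y \<bullet> b)) + y \<bullet> y" .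
    then show ?thesis by (simp only:) (simp add: algebra_simps sum_distrib_left)
  qed
  have eq: "(\<Prod>i\<in>insert j J. c i - d i * (dist x y)\<^sup>2) =
     (\<Sum>g\<in>sphere_monomials ?t. w g * ((c j - d j * (x \<bullet> x)) * g y
        + (\<Sum>b\<in>Basis. (2 * d j * (x \<bullet> b)) * ((y \<bullet> b) * g y)) + (- d j) * ((y \<bullet> y) * g y)))" for y
    unfolding prod.insert[OF insert.hyps] w dist_eq sum_distrib_left
    by (intro sum.cong refl) (simp add: algebra_simps sum_distrib_left)
  have "?L (\<lambda>y. \<Prod>i\<in>insert j J. c i - d i * (dist x y)\<^sup>2)"
    unfolding eq
    by (intro lincomb_sum lincomb_scale lincomb_add sphere_monomials_mult)
  then show ?case using insert.hyps by simp
qed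

lemma lincomb_family_factorization:
  assumes T: "finite T" "card T \<le> N" and f: "\<And>x. lincomb T (f x)"
  shows "\<exists>p q. \<forall>x y. f x y = (\<Sum>a<N. p a x * q a y)"
proof -
  obtain w where w: "\<And>x y. f x y = (\<Sum>g\<in>T. w x g * g y)"
    using f unfolding lincomb_def by metis
  obtain \<phi> where \<phi>: "bij_betw \<phi> {..<card T} T"
    using ex_bij_betw_nat_finite[OF T(1)] by (auto simp: atLeast0LessThan)
  \<comment> \<open>Zero coefficients pad the sum from \<open>card T\<close> up to \<open>N\<close>
    terms.\<close>
  let ?p = "\<lambda>a x. if a < card T then w x (\<phi> a) else 0"
  have "f x y = (\<Sum>a<N. ?p a x * \<phi> a y)" for x y
  proof -
    have "f x y = (\<Sum>a<card T. w x (\<phi> a) * \<phi> a y)"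
      using sum.reindex_bij_betw[OF \<phi>, of "\<lambda>g. w x g * g y"] by (simp add: w)
    also have "\<dots> = (\<Sum>a<N. ?p a x * \<phi> a y)"
      using T(2) by (intro sum.mono_neutral_cong_left) auto
    finally show ?thesis .
  qed
  then show ?thesis by (intro exI[of _ ?p] exI[of _ \<phi>]) blast
qed

section \<open>Application to distance sets\<close>

theorem theorem3p1:
  fixes X :: "'a::euclidean_space set" and s N :: nat and \<alpha> :: "nat \<Rightarrow> real"
  assumes "s \<ge> 2"
    and "s_distance_set s X"
    and "dist_set X = \<alpha> ` {1..s}"
    and "N = ((DIM('a) + s - 1) choose (s - 1)) + ((DIM('a) + s - 2) choose (s - 2))"
    and "card X \<ge> 2 * N"
  shows "\<forall>i\<in>{1..s}. \<exists>z::int.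
           (\<Prod>j\<in>{1..s} - {i}. (\<alpha> j)^2 / ((\<alpha> j)^2 - (\<alpha> i)^2)) = of_int z
           \<and> \<bar>z\<bar> \<le> U N"
proof
  fix i assume i: "i \<in> {1..s}"
  obtain t where s: "s = Suc (Suc t)" using assms(1) by (metis add_2_eq_Suc le_Suc_ex)
  have N: "N = ((DIM('a) + Suc t) choose Suc t) + ((DIM('a) + t) choose t)"
    using assms(4) by (simp add: s)
  have "(DIM('a) + Suc t) choose Suc t > 0" "(DIM('a) + t) choose t > 0"
    by (simp_all only: zero_less_binomial_iff le_add2)
  then have N2: "N \<ge> 2" unfolding N by linarith
  have inj: "inj_on \<alpha> {1..s}"
    using assms(2,3) by (intro eq_card_imp_inj_on) (auto simp: s_distance_set_def)
  have pos: "\<alpha> j > 0" if "j \<in> {1..s}" for j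
  proof -
    have "\<alpha> j \<in> dist_set X" using that assms(3) by blast
    then show ?thesis by (auto simp: dist_set_def)
  qed
  have sq_neq: "(\<alpha> j)\<^sup>2 \<noteq> (\<alpha> i)\<^sup>2" if "j \<in> {1..s} - {i}" for j
    using that pos[of j] pos[OF i] inj_onD[OF inj, of j i] i by (auto simp: power2_eq_iff)
  define k where "k = (\<Prod>j\<in>{1..s} - {i}. (\<alpha> j)^2 / ((\<alpha> j)^2 - (\<alpha> i)^2))"
  \<comment> \<open>The factors of the overview's \<open>M\<close>, split into the shape required by
    \<open>lincomb_prod_dist\<close>. At distance 0 the product is \<open>k\<close>, at distance
    \<open>\<alpha> i\<close> every factor is 1, and at any other distance in \<open>X\<close> some
    factor is 0.\<close>
  define f where "f x y = (\<Prod>j\<in>{1..s} - {i}. (\<alpha> j)\<^sup>2 / ((\<alpha> j)\<^sup>2 - (\<alpha> i)\<^sup>2)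
      - 1 / ((\<alpha> j)\<^sup>2 - (\<alpha> i)\<^sup>2) * (dist x y)\<^sup>2)" for x y :: 'a
  have k0: "k \<noteq> 0" unfolding k_def using sq_neq pos by (subst prod_zero_iff) fastforce+
  have f_self: "f x x = k" for x by (simp add: f_def k_def)
  have f_neq: "f x y = of_bool (dist x y = \<alpha> i)" if "x \<in> X" "y \<in> X" "x \<noteq> y" for x y
  proof -
    have "dist x y \<in> dist_set X" using that by (auto simp: dist_set_def)
    then obtain l where l: "l \<in> {1..s}" "dist x y = \<alpha> l" using assms(3) by auto
    show ?thesis
    proof (cases "l = i")
      case True
      then show ?thesis
        unfolding f_def using l sq_neq by (auto intro!: prod.neutral simp flip: diff_divide_distrib)
    next
      case False
      then have "\<alpha> l \<noteq> \<alpha> i" using inj_onD[OF inj] l i by blast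
      moreover have "f x y = 0"
        unfolding f_def using l False by (intro prod_zero) (auto intro!: bexI[of _ l])
      ultimately show ?thesis using l by simp
    qed
  qed
  have "card ({1..s} - {i}) = Suc t" using i by (simp add: s)
  then have "lincomb (sphere_monomials (Suc t)) (f x)" for x
    using lincomb_prod_dist[of "{1..s} - {i}" "\<lambda>j. (\<alpha> j)\<^sup>2 / ((\<alpha> j)\<^sup>2 - (\<alpha> i)\<^sup>2)"
        "\<lambda>j. 1 / ((\<alpha> j)\<^sup>2 - (\<alpha> i)\<^sup>2)" x]
    by (simp only: f_def[abs_def] finite_Diff finite_atLeastAtMost)
  then obtain p q where pq: "\<And>x y. f x y = (\<Sum>a<N. p a x * q a y)"
    using lincomb_family_factorization[OF finite_sphere_monomials, of "Suc t" N f]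
      card_sphere_monomials_le[of t, where 'a = 'a] unfolding N by blast
  \<comment> \<open>Exactly \<open>2 * N\<close> points are kept, so that rank \<open>N\<close> is
    half the matrix size.\<close>
  obtain Y where Y: "Y \<subseteq> X" "card Y = 2 * N" "finite Y"
    using obtain_subset_with_card_n[OF assms(5)] by metis
  obtain h where h: "bij_betw h {..<2 * N} Y"
    using ex_bij_betw_nat_finite[OF Y(3)] by (auto simp: Y(2) atLeast0LessThan)
  have hX: "h a \<in> X" if "a < 2 * N" for a using bij_betwE[OF h] that Y(1) by blast
  have h_inj: "h a \<noteq> h b" if "a < 2 * N" "b < 2 * N" "a \<noteq> b" for a b
    using bij_betw_imp_inj_on[OF h] that by (auto dest: inj_onD)
  have fact: "(if a = b then k else of_bool (dist (h a) (h b) = \<alpha> i)) = (\<Sum>c<N. p c (h a) * q c (h b))"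
    if "a < 2 * N" "b < 2 * N" for a b
    using that by (auto simp: f_self f_neq hX h_inj simp flip: pq)
  have "k \<in> \<int>"
    by (rule low_rank_diagonal_in_Ints[where N = N and E = "\<lambda>a b. dist (h a) (h b) = \<alpha> i"
          and p = "\<lambda>c a. p c (h a)" and q = "\<lambda>c a. q c (h a)", OF _ k0 _ _ fact])
       (use N2 pos[OF i] in \<open>auto simp: dist_commute\<close>)
  then obtain z where z: "k = of_int z" by (rule Ints_cases)
  moreover have "\<lfloor>\<bar>k\<bar>\<rfloor> \<le> U N"
    using fact by (rule low_rank_abs_diagonal_le_U[OF N2])
  ultimately show "\<exists>z::int. (\<Prod>j\<in>{1..s} - {i}. (\<alpha> j)^2 / ((\<alpha> j)^2 - (\<alpha> i)^2)) = of_int z \<and> \<bar>z\<bar> \<le> U N"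
    unfolding k_def[symmetric] by (metis floor_of_int of_int_abs)
qed

end
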